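(* Let $\mu$ be a quasi-definite measure on $\mathbb T$ which is either a positive measure, or a complex measure of the form $d\mu(\theta)=w(\theta)\,d\theta$ with $w$ a continuous function on $\mathbb T$. Then, for all $l\ge 0$, the partial second kind functions of $\mu$ are the Cauchy integrals $$C_{1,1}^{(l)}(z)=z^{-1}\oint_{\mathbb T}\frac{u\,\varphi_2^{(l)}(u)}{u-z^{-1}}\,\overline{d\mu(u)},\qquad C_{2,1}^{(l)}(z)=z^{-1}\oint_{\mathbb T}\frac{u\,\varphi_1^{(l)}(u)}{u-z^{-1}}\,d\mu(u),\qquad |z|>1,$$ $$C_{1,2}^{(l)}(z)=-z^{-1}\oint_{\mathbb T}\frac{u\,\varphi_2^{(l)}(u)}{u-z^{-1}}\,\overline{d\mu(u)},\qquad C_{2,2}^{(l)}(z)=-z^{-1}\oint_{\mathbb T}\frac{u\,\varphi_1^{(l)}(u)}{u-z^{-1}}\,d\mu(u),\qquad 0<|z|<1.$$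
   Context: $\mathbb T$ is the unit circle; $\oint_{\mathbb T}f(u)\,d\mu(u)$ is the integral of $f$ against $\mu$, and $\overline{d\mu}$ is the complex conjugate measure. $\mu$ is quasi-definite if all Toeplitz matrices $\big(\oint_{\mathbb T}z^{i-j}d\mu\big)_{i,j=0}^n$, $n\ge0$, are non-singular. Indices start at $0$; $\dagger$ is the conjugate transpose. $\chi_1(z)=(1,0,z,0,z^2,\dots)^\top$, $\chi_2(z)=(0,1,0,z,0,z^2,\dots)^\top$, $\chi_a^*(z)=z^{-1}\chi_a(z^{-1})$, $\chi=\chi_1+\chi_2^*=(1,z^{-1},z,z^{-2},\dots)^\top$. CMV moment matrix $g=\oint_{\mathbb T}\chi(z)\chi(z)^\dagger d\mu(z)=S_1^{-1}S_2$ with $S_1$ lower unitriangular and $S_2$ upper triangular (unique). $\varphi_1^{(l)}=(S_1\chi)^{(l)}$, $\varphi_2^{(l)}=((S_2^{-1})^\dagger\chi)^{(l)}$. Partial second kind functions (components of series defined by matrix products): $C_{1,1}=(S_1^{-1})^\dagger\chi_1^*$, $C_{1,2}=(S_1^{-1})^\dagger\chi_2$, $C_{2,1}=S_2\chi_1^*$, $C_{2,2}=S_2\chi_2$; $C_{a,b}^{(l)}$ is the $l$-th component of $C_{a,b}$. *)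

theory Defs
  imports "HOL-Analysis.Analysis" "Jordan_Normal_Form.Determinant"
begin

section \<open>Measures on the unit circle\<close>

abbreviation circle :: "complex set" where
  "circle \<equiv> sphere 0 1"

definition circle_borel :: "complex measure" where
  "circle_borel = restrict_space borel circle"

text \<open>
  A complex measure \<open>d\<mu> = h d\<nu>\<close> is represented by the pair \<open>(\<nu>, h)\<close> of a positive
  measure \<open>\<nu>\<close> on the circle and a density \<open>h\<close>. Positive measures have \<open>h = 1\<close>. All integrands
  used below are continuous on the circle and all measures considered are finite with bounded
  density, so every Bochner integral occurring here exists.
\<close>

type_synonym circle_measure = "complex measure \<times> (complex \<Rightarrow> complex)"

definition cintegral :: "circle_measure \<Rightarrow> (complex \<Rightarrow> complex) \<Rightarrow> complex" where
  "cintegral \<mu> f = (LINT u|fst \<mu>. f u * snd \<mu> u)"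

definition conj_measure :: "circle_measure \<Rightarrow> circle_measure" where
  "conj_measure \<mu> = (fst \<mu>, \<lambda>u. cnj (snd \<mu> u))"

definition positive_circle_measure :: "circle_measure \<Rightarrow> bool" where
  "positive_circle_measure \<mu> \<longleftrightarrow>
     sets (fst \<mu>) = sets circle_borel \<and> finite_measure (fst \<mu>) \<and> snd \<mu> = (\<lambda>_. 1)"

text \<open>The measure \<open>d\<theta>\<close>, of total mass \<open>2\<pi>\<close>.\<close>

definition arc_measure :: "complex measure" where
  "arc_measure = distr (restrict_space lborel {0..<2 * pi}) circle_borel cis"

definition continuous_density_measure :: "circle_measure \<Rightarrow> bool" where
  "continuous_density_measure \<mu> \<longleftrightarrow> fst \<mu> = arc_measure \<and> continuous_on circle (snd \<mu>)"

definition toeplitz_matrix :: "circle_measure \<Rightarrow> nat \<Rightarrow> complex mat" where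
  "toeplitz_matrix \<mu> n =
     Matrix.mat (n + 1) (n + 1) (\<lambda>(i, j). cintegral \<mu> (\<lambda>u. u powi (int i - int j)))"

definition quasi_definite :: "circle_measure \<Rightarrow> bool" where
  "quasi_definite \<mu> \<longleftrightarrow> (\<forall>n. Determinant.det (toeplitz_matrix \<mu> n) \<noteq> 0)"


section \<open>Semi-infinite matrices and vectors\<close>

type_synonym imat = "nat \<Rightarrow> nat \<Rightarrow> complex"
type_synonym ivec = "nat \<Rightarrow> complex"

text \<open>
  The entries of matrix products are series. They are finite sums for all products used here,
  except in the partial second kind functions, where an upper triangular matrix is applied to a
  vector.
\<close>

definition imat_mult :: "imat \<Rightarrow> imat \<Rightarrow> imat" where
  "imat_mult A B = (\<lambda>i j. \<Sum>k. A i k * B k j)"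

definition imat_vec :: "imat \<Rightarrow> ivec \<Rightarrow> ivec" where
  "imat_vec A v = (\<lambda>i. \<Sum>k. A i k * v k)"

definition imat_vec_summable :: "imat \<Rightarrow> ivec \<Rightarrow> nat \<Rightarrow> bool" where
  "imat_vec_summable A v i \<longleftrightarrow> summable (\<lambda>k. A i k * v k)"

definition imat_one :: imat where
  "imat_one = (\<lambda>i j. if i = j then 1 else 0)"

definition imat_adjoint :: "imat \<Rightarrow> imat" where
  "imat_adjoint A = (\<lambda>i j. cnj (A j i))"

definition ilower_triangular :: "imat \<Rightarrow> bool" where
  "ilower_triangular A \<longleftrightarrow> (\<forall>i j. i < j \<longrightarrow> A i j = 0)"

definition iupper_triangular :: "imat \<Rightarrow> bool" where
  "iupper_triangular A \<longleftrightarrow> (\<forall>i j. j < i \<longrightarrow> A i j = 0)"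

definition ilower_unitriangular :: "imat \<Rightarrow> bool" where
  "ilower_unitriangular A \<longleftrightarrow> ilower_triangular A \<and> (\<forall>i. A i i = 1)"

text \<open>
  Two-sided inverses of semi-infinite matrices need not be unique in general, but they are among
  the lower (or the upper) triangular matrices.
\<close>

definition lower_inverse :: "imat \<Rightarrow> imat" where
  "lower_inverse A =
     (THE B. ilower_triangular B \<and> imat_mult A B = imat_one \<and> imat_mult B A = imat_one)"

definition upper_inverse :: "imat \<Rightarrow> imat" where
  "upper_inverse A =
     (THE B. iupper_triangular B \<and> imat_mult A B = imat_one \<and> imat_mult B A = imat_one)"


section \<open>CMV moment matrix and its Gauss factorization\<close>

definition chi1 :: "complex \<Rightarrow> ivec" where
  "chi1 z = (\<lambda>j. if even j then z ^ (j div 2) else 0)"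

definition chi2 :: "complex \<Rightarrow> ivec" where
  "chi2 z = (\<lambda>j. if odd j then z ^ (j div 2) else 0)"

definition chi1_star :: "complex \<Rightarrow> ivec" where
  "chi1_star z = (\<lambda>j. inverse z * chi1 (inverse z) j)"

definition chi2_star :: "complex \<Rightarrow> ivec" where
  "chi2_star z = (\<lambda>j. inverse z * chi2 (inverse z) j)"

definition chi :: "complex \<Rightarrow> ivec" where
  "chi z = (\<lambda>j. chi1 z j + chi2_star z j)"

definition cmv_moment_matrix :: "circle_measure \<Rightarrow> imat" where
  "cmv_moment_matrix \<mu> = (\<lambda>i j. cintegral \<mu> (\<lambda>u. chi u i * cnj (chi u j)))"

text \<open>For quasi-definite \<open>\<mu>\<close> the pair \<open>(S\<^sub>1, S\<^sub>2)\<close> exists and is unique.\<close>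

definition gauss_factors :: "circle_measure \<Rightarrow> imat \<times> imat" where
  "gauss_factors \<mu> =
     (THE S. ilower_unitriangular (fst S) \<and> iupper_triangular (snd S) \<and>
        cmv_moment_matrix \<mu> = imat_mult (lower_inverse (fst S)) (snd S))"

definition S1 :: "circle_measure \<Rightarrow> imat" where
  "S1 \<mu> = fst (gauss_factors \<mu>)"

definition S2 :: "circle_measure \<Rightarrow> imat" where
  "S2 \<mu> = snd (gauss_factors \<mu>)"

definition phi1 :: "circle_measure \<Rightarrow> nat \<Rightarrow> complex \<Rightarrow> complex" where
  "phi1 \<mu> l z = imat_vec (S1 \<mu>) (chi z) l"

definition phi2 :: "circle_measure \<Rightarrow> nat \<Rightarrow> complex \<Rightarrow> complex" where
  "phi2 \<mu> l z = imat_vec (imat_adjoint (upper_inverse (S2 \<mu>))) (chi z) l"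


section \<open>Partial second kind functions\<close>

abbreviation S1_inv_adjoint :: "circle_measure \<Rightarrow> imat" where
  "S1_inv_adjoint \<mu> \<equiv> imat_adjoint (lower_inverse (S1 \<mu>))"

definition C11 :: "circle_measure \<Rightarrow> nat \<Rightarrow> complex \<Rightarrow> complex" where
  "C11 \<mu> l z = imat_vec (S1_inv_adjoint \<mu>) (chi1_star z) l"

definition C12 :: "circle_measure \<Rightarrow> nat \<Rightarrow> complex \<Rightarrow> complex" where
  "C12 \<mu> l z = imat_vec (S1_inv_adjoint \<mu>) (chi2 z) l"

definition C21 :: "circle_measure \<Rightarrow> nat \<Rightarrow> complex \<Rightarrow> complex" where
  "C21 \<mu> l z = imat_vec (S2 \<mu>) (chi1_star z) l"

definition C22 :: "circle_measure \<Rightarrow> nat \<Rightarrow> complex \<Rightarrow> complex" where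
  "C22 \<mu> l z = imat_vec (S2 \<mu>) (chi2 z) l"

end

theory Submission
  imports Defs
begin

text \<open>
  On the unit circle the entries of \<open>\<chi>\<close> are powers of \<open>u\<close> and complex conjugation inverts them.
  The entries of \<open>S\<^sub>2\<close> and of the adjoint of \<open>S\<^sub>1\<^sup>-\<^sup>1\<close> turn out to be Fourier coefficients, and the
  product of such a matrix with \<open>\<chi>\<^sub>1\<^sup>*\<close> or \<open>\<chi>\<^sub>2\<close> is one half of a Fourier series, that is, a
  geometric series under the integral sign. Its sum is the Cauchy kernel.

  In detail, \<open>S\<^sub>2 = S\<^sub>1 g\<close> says that the entry \<open>(l, k)\<close> of \<open>S\<^sub>2\<close> is the integral of
  \<open>\<phi>\<^sub>1\<^sup>(\<^sup>l\<^sup>)\<close> times the conjugate of \<open>\<chi>\<^sup>(\<^sup>k\<^sup>)\<close> against \<open>\<mu>\<close>, and the adjoint of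
  \<open>S\<^sub>1\<^sup>-\<^sup>1 = g S\<^sub>2\<^sup>-\<^sup>1\<close> says the same of the adjoint of \<open>S\<^sub>1\<^sup>-\<^sup>1\<close>, with \<open>\<phi>\<^sub>2\<^sup>(\<^sup>l\<^sup>)\<close> and the
  conjugate measure (lemmas \<open>S2_eq_fourier_coefficient\<close> and
  \<open>S1_inv_adjoint_eq_fourier_coefficient\<close>). The even entries \<open>k = 2m\<close> paired with \<open>\<chi>\<^sub>1\<^sup>*(z)\<close> give
  the sum of \<open>z\<^sup>-\<^sup>1 (zu)\<^sup>-\<^sup>m\<close>, which converges uniformly in \<open>u\<close> for \<open>|z| > 1\<close>; the odd entries
  \<open>k = 2m + 1\<close> paired with \<open>\<chi>\<^sub>2(z)\<close> give the sum of \<open>u (zu)\<^sup>m\<close>, which converges uniformly for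
  \<open>|z| < 1\<close>. Both sums are \<open>z\<^sup>-\<^sup>1 u / (u - z\<^sup>-\<^sup>1)\<close> up to the sign. One argument serves both kinds of
  measures, because each of them is a finite measure times a bounded density.

  The identities \<open>S\<^sub>2 = S\<^sub>1 g\<close> and \<open>S\<^sub>1\<^sup>-\<^sup>1 = g S\<^sub>2\<^sup>-\<^sup>1\<close> require the existence and uniqueness of the Gauss
  factorization and of the triangular inverses. The exponents of the first \<open>n\<close> entries of \<open>\<chi>\<close> are
  \<open>n\<close> consecutive integers, so the leading \<open>n \<times> n\<close> block of \<open>g\<close> is a Toeplitz matrix whose rows and
  columns have undergone the same permutation. Quasi-definiteness thus makes all leading blocks
  invertible, which determines the rows of \<open>S\<^sub>1\<close> and makes the diagonal of \<open>S\<^sub>2\<close> nonzero.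
\<close>


section \<open>Triangular semi-infinite matrices\<close>

lemma imat_mult_finite:
  assumes "finite K" and "\<And>k. k \<notin> K \<Longrightarrow> A i k * B k j = 0"
  shows "imat_mult A B i j = (\<Sum>k\<in>K. A i k * B k j)"
  unfolding imat_mult_def using assms by (intro suminf_finite) auto

lemma imat_mult_lower:
  assumes "ilower_triangular A"
  shows "imat_mult A B i j = (\<Sum>k\<le>i. A i k * B k j)"
  using assms by (intro imat_mult_finite) (auto simp: ilower_triangular_def)

lemma imat_mult_upper:
  assumes "iupper_triangular B"
  shows "imat_mult A B i j = (\<Sum>k\<le>j. A i k * B k j)"
  using assms by (intro imat_mult_finite) (auto simp: iupper_triangular_def)

lemma imat_mult_one_left: "imat_mult imat_one A = A"
proof (intro ext)
  fix i j
  have "imat_mult imat_one A i j = (\<Sum>k\<in>{i}. imat_one i k * A k j)"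
    by (rule imat_mult_finite) (auto simp: imat_one_def)
  then show "imat_mult imat_one A i j = A i j"
    by (simp add: imat_one_def)
qed

lemma imat_mult_one_right: "imat_mult A imat_one = A"
proof (intro ext)
  fix i j
  have "imat_mult A imat_one i j = (\<Sum>k\<in>{j}. A i k * imat_one k j)"
    by (rule imat_mult_finite) (auto simp: imat_one_def)
  then show "imat_mult A imat_one i j = A i j"
    by (simp add: imat_one_def)
qed

text \<open>Products of semi-infinite matrices are not associative in general. Here, and when the outer two
  factors are a lower and an upper triangular matrix, every series involved is a finite sum.\<close>

lemma imat_mult_assoc_lower_lower:
  assumes A: "ilower_triangular A" and B: "ilower_triangular B"
  shows "imat_mult (imat_mult A B) C = imat_mult A (imat_mult B C)"
proof (intro ext)
  fix i l
  have AB: "imat_mult A B i j = 0" if "i < j" for j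
    using A B that by (auto simp: imat_mult_lower ilower_triangular_def intro!: sum.neutral)
  have "imat_mult (imat_mult A B) C i l = (\<Sum>j\<le>i. imat_mult A B i j * C j l)"
    using AB by (intro imat_mult_finite) auto
  also have "\<dots> = (\<Sum>k\<le>i. \<Sum>j\<le>i. A i k * B k j * C j l)"
    by (subst sum.swap) (simp add: imat_mult_lower[OF A] sum_distrib_right)
  also have "\<dots> = (\<Sum>k\<le>i. A i k * imat_mult B C k l)"
  proof (intro sum.cong refl)
    fix k assume "k \<in> {..i}"
    then have "imat_mult B C k l = (\<Sum>j\<le>i. B k j * C j l)"
      using B by (intro imat_mult_finite) (auto simp: ilower_triangular_def)
    then show "(\<Sum>j\<le>i. A i k * B k j * C j l) = A i k * imat_mult B C k l"
      by (simp add: sum_distrib_left mult.assoc)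
  qed
  finally show "imat_mult (imat_mult A B) C i l = imat_mult A (imat_mult B C) i l"
    by (simp add: imat_mult_lower[OF A])
qed

lemma imat_mult_assoc_lower_upper:
  assumes A: "ilower_triangular A" and C: "iupper_triangular C"
  shows "imat_mult (imat_mult A B) C = imat_mult A (imat_mult B C)"
proof (intro ext)
  fix i l
  have "imat_mult (imat_mult A B) C i l = (\<Sum>j\<le>l. \<Sum>k\<le>i. A i k * B k j * C j l)"
    by (simp add: imat_mult_upper[OF C] imat_mult_lower[OF A] sum_distrib_right)
  also have "\<dots> = (\<Sum>k\<le>i. A i k * imat_mult B C k l)"
    by (subst sum.swap) (simp add: imat_mult_upper[OF C] sum_distrib_left mult.assoc)
  finally show "imat_mult (imat_mult A B) C i l = imat_mult A (imat_mult B C) i l"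
    by (simp add: imat_mult_lower[OF A])
qed

text \<open>Forward substitution: row \<open>i\<close> of a right inverse is determined by the rows above it.\<close>

function forward_substitution :: "imat \<Rightarrow> imat" where
  "forward_substitution A i j =
     ((if i = j then 1 else 0) - (\<Sum>k<i. A i k * forward_substitution A k j)) / A i i"
  by pat_completeness auto
termination by (relation "Wellfounded.measure (\<lambda>(A, i, j). i)") auto

declare forward_substitution.simps [simp del]

lemma forward_substitution_above_diagonal:
  "i < j \<Longrightarrow> forward_substitution A i j = 0"
proof (induction i rule: less_induct)
  case (less i)
  then show ?case
    by (subst forward_substitution.simps) (auto intro!: sum.neutral)
qed

lemma forward_substitution_lower: "ilower_triangular (forward_substitution A)"
  by (simp add: ilower_triangular_def forward_substitution_above_diagonal)

lemma forward_substitution_diagonal: "forward_substitution A i i = 1 / A i i"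
  by (subst forward_substitution.simps)
    (auto simp: forward_substitution_above_diagonal intro!: sum.neutral)

lemma forward_substitution_right_inverse:
  assumes "ilower_triangular A" and "\<And>i. A i i \<noteq> 0"
  shows "imat_mult A (forward_substitution A) = imat_one"
proof (intro ext)
  fix i j
  have "imat_mult A (forward_substitution A) i j =
      (\<Sum>k<i. A i k * forward_substitution A k j) + A i i * forward_substitution A i j"
    by (simp add: imat_mult_lower[OF assms(1)] flip: lessThan_Suc_atMost)
  also have "\<dots> = imat_one i j"
    using assms(2)[of i]
    by (subst (2) forward_substitution.simps) (simp add: imat_one_def)
  finally show "imat_mult A (forward_substitution A) i j = imat_one i j" .
qed

lemma lower_inverse_exists:
  assumes A: "ilower_triangular A" "\<And>i. A i i \<noteq> 0"
  shows "\<exists>B. ilower_triangular B \<and> imat_mult A B = imat_one \<and> imat_mult B A = imat_one"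
proof -
  let ?B = "forward_substitution A"
  let ?C = "forward_substitution ?B"
  have B: "ilower_triangular ?B"
    by (rule forward_substitution_lower)
  have AB: "imat_mult A ?B = imat_one"
    using A by (rule forward_substitution_right_inverse)
  have BC: "imat_mult ?B ?C = imat_one"
    using A(2) B by (intro forward_substitution_right_inverse) (auto simp: forward_substitution_diagonal)
  \<comment> \<open>A right inverse of the right inverse coincides with \<open>A\<close>.\<close>
  have "A = imat_mult A (imat_mult ?B ?C)"
    by (simp add: BC imat_mult_one_right)
  also have "\<dots> = ?C"
    by (simp add: AB imat_mult_one_left flip: imat_mult_assoc_lower_lower[OF A(1) B])
  finally have "imat_mult ?B A = imat_one"
    using BC by simp
  with AB B show ?thesis
    by blast
qed

lemma lower_inverse_unique:
  assumes "ilower_triangular A"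
    and B: "ilower_triangular B" "imat_mult B A = imat_one"
    and C: "imat_mult A C = imat_one"
  shows "B = C"
proof -
  have "B = imat_mult B (imat_mult A C)"
    by (simp add: C imat_mult_one_right)
  also have "\<dots> = imat_mult (imat_mult B A) C"
    by (rule imat_mult_assoc_lower_lower[OF B(1) assms(1), symmetric])
  also have "\<dots> = C"
    by (simp add: B imat_mult_one_left)
  finally show ?thesis .
qed

lemma lower_inverse:
  assumes A: "ilower_triangular A" "\<And>i. A i i \<noteq> 0"
  shows lower_inverse_lower: "ilower_triangular (lower_inverse A)"
    and lower_inverse_right: "imat_mult A (lower_inverse A) = imat_one"
    and lower_inverse_left: "imat_mult (lower_inverse A) A = imat_one"
proof -
  have "\<exists>!B. ilower_triangular B \<and> imat_mult A B = imat_one \<and> imat_mult B A = imat_one"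
    using lower_inverse_exists[OF A] lower_inverse_unique[OF A(1)] by blast
  from theI'[OF this] show "ilower_triangular (lower_inverse A)"
    "imat_mult A (lower_inverse A) = imat_one" "imat_mult (lower_inverse A) A = imat_one"
    unfolding lower_inverse_def by blast+
qed

text \<open>The plain transpose: unlike the adjoint, it carries the equations for an inverse over without
  conjugates.\<close>

definition imat_transpose :: "imat \<Rightarrow> imat" where
  "imat_transpose A = (\<lambda>i j. A j i)"

lemma imat_transpose_transpose: "imat_transpose (imat_transpose A) = A"
  by (simp add: imat_transpose_def)

lemma imat_transpose_mult:
  "imat_transpose (imat_mult A B) = imat_mult (imat_transpose B) (imat_transpose A)"
  by (simp add: imat_transpose_def imat_mult_def mult.commute)

lemma imat_transpose_one: "imat_transpose imat_one = imat_one"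
  by (auto simp: imat_transpose_def imat_one_def fun_eq_iff)

lemma lower_triangular_transpose:
  "ilower_triangular (imat_transpose A) \<longleftrightarrow> iupper_triangular A"
  by (auto simp: imat_transpose_def ilower_triangular_def iupper_triangular_def)

text \<open>Transposition turns the existence and the uniqueness of the inverse of an upper triangular
  matrix into the same statements for lower triangular matrices.\<close>

lemma upper_inverse:
  assumes A: "iupper_triangular A" "\<And>i. A i i \<noteq> 0"
  shows upper_inverse_upper: "iupper_triangular (upper_inverse A)"
    and upper_inverse_right: "imat_mult A (upper_inverse A) = imat_one"
proof -
  let ?T = "imat_transpose A"
  let ?P = "\<lambda>B. iupper_triangular B \<and> imat_mult A B = imat_one \<and> imat_mult B A = imat_one"
  let ?Q = "\<lambda>B. ilower_triangular B \<and> imat_mult ?T B = imat_one \<and> imat_mult B ?T = imat_one"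
  have T: "ilower_triangular ?T" "\<And>i. ?T i i \<noteq> 0"
    using A lower_triangular_transpose[of A] by (simp_all add: imat_transpose_def)
  have P_iff: "?P B \<longleftrightarrow> ?Q (imat_transpose B)" for B
    using lower_triangular_transpose[of B] imat_transpose_mult[of A B] imat_transpose_mult[of B A]
    by (metis imat_transpose_transpose imat_transpose_one)
  have "\<exists>!B. ?P B"
  proof (rule ex_ex1I)
    show "\<exists>B. ?P B"
      using lower_inverse_exists[OF T] unfolding P_iff by (metis imat_transpose_transpose)
  next
    fix B C assume "?P B" "?P C"
    then have "imat_transpose B = imat_transpose C"
      unfolding P_iff using lower_inverse_unique[OF T(1)] by blast
    then show "B = C"
      by (metis imat_transpose_transpose)
  qed
  from theI'[OF this] show "iupper_triangular (upper_inverse A)"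
    "imat_mult A (upper_inverse A) = imat_one"
    unfolding upper_inverse_def by blast+
qed

section \<open>Gauss factorization of a semi-infinite matrix\<close>

text \<open>An inverse given by a function on indices can be reindexed by a permutation and multiplied with
  rows of semi-infinite matrices without passing through matrices of a fixed dimension.\<close>

definition block_invertible :: "imat \<Rightarrow> nat \<Rightarrow> bool" where
  "block_invertible g n \<longleftrightarrow> (\<exists>R. \<forall>i<n. \<forall>j<n.
     (\<Sum>k<n. R i k * g k j) = imat_one i j \<and> (\<Sum>k<n. g i k * R k j) = imat_one i j)"

lemma block_invertible_if_det_nonzero:
  assumes "Determinant.det (Matrix.mat n n (\<lambda>(i, j). g i j)) \<noteq> 0"
  shows "block_invertible g n"
proof -
  let ?A = "Matrix.mat n n (\<lambda>(i, j). g i j)"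
  have "?A \<in> carrier_mat n n"
    by simp
  from det_non_zero_imp_unit[OF this assms]
  obtain B where B: "B \<in> carrier_mat n n" "B * ?A = 1\<^sub>m n" "?A * B = 1\<^sub>m n"
    unfolding Units_def ring_mat_def by auto
  show ?thesis
    unfolding block_invertible_def
  proof (intro exI allI impI conjI)
    fix i j assume ij: "i < n" "j < n"
    have "(B * ?A) $$ (i, j) = (\<Sum>k<n. B $$ (i, k) * g k j)"
      using ij B(1) by (simp add: scalar_prod_def atLeast0LessThan)
    then show "(\<Sum>k<n. B $$ (i, k) * g k j) = imat_one i j"
      using ij by (simp add: B imat_one_def)
    have "(?A * B) $$ (i, j) = (\<Sum>k<n. g i k * B $$ (k, j))"
      using ij B(1) by (simp add: scalar_prod_def atLeast0LessThan)
    then show "(\<Sum>k<n. g i k * B $$ (k, j)) = imat_one i j"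
      using ij by (simp add: B imat_one_def)
  qed
qed

lemma block_invertible_reindex:
  assumes T: "block_invertible T n"
    and \<sigma>: "bij_betw \<sigma> {..<n} {..<n}"
    and g: "\<And>i j. i < n \<Longrightarrow> j < n \<Longrightarrow> g i j = T (\<sigma> i) (\<sigma> j)"
  shows "block_invertible g n"
proof -
  obtain R where R: "\<And>i j. i < n \<Longrightarrow> j < n \<Longrightarrow> (\<Sum>k<n. R i k * T k j) = imat_one i j"
    "\<And>i j. i < n \<Longrightarrow> j < n \<Longrightarrow> (\<Sum>k<n. T i k * R k j) = imat_one i j"
    using T unfolding block_invertible_def by blast
  have \<sigma>_less: "\<sigma> i < n" if "i < n" for i
    using \<sigma> that by (auto simp: bij_betw_def)
  have one: "imat_one (\<sigma> i) (\<sigma> j) = imat_one i j" if "i < n" "j < n" for i j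
    using \<sigma> that by (auto simp: bij_betw_def inj_on_def imat_one_def)
  show ?thesis
    unfolding block_invertible_def
  proof (intro exI[of _ "\<lambda>i j. R (\<sigma> i) (\<sigma> j)"] allI impI conjI)
    fix i j assume ij: "i < n" "j < n"
    have "(\<Sum>k<n. R (\<sigma> i) (\<sigma> k) * g k j) = (\<Sum>k<n. R (\<sigma> i) (\<sigma> k) * T (\<sigma> k) (\<sigma> j))"
      using ij by (simp add: g)
    also have "\<dots> = (\<Sum>k<n. R (\<sigma> i) k * T k (\<sigma> j))"
      by (rule sum.reindex_bij_betw[OF \<sigma>])
    finally show "(\<Sum>k<n. R (\<sigma> i) (\<sigma> k) * g k j) = imat_one i j"
      using ij by (simp add: R \<sigma>_less one)
    have "(\<Sum>k<n. g i k * R (\<sigma> k) (\<sigma> j)) = (\<Sum>k<n. T (\<sigma> i) (\<sigma> k) * R (\<sigma> k) (\<sigma> j))"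
      using ij by (simp add: g)
    also have "\<dots> = (\<Sum>k<n. T (\<sigma> i) k * R k (\<sigma> j))"
      by (rule sum.reindex_bij_betw[OF \<sigma>])
    finally show "(\<Sum>k<n. g i k * R (\<sigma> k) (\<sigma> j)) = imat_one i j"
      using ij by (simp add: R \<sigma>_less one)
  qed
qed

text \<open>\<open>x = x g R = 0\<close>, where \<open>R\<close> is a right inverse of the block.\<close>

lemma block_invertible_left_kernel:
  assumes "block_invertible g n"
    and x: "\<And>k. k < n \<Longrightarrow> (\<Sum>j<n. x j * g j k) = 0"
    and i: "i < n"
  shows "x i = 0"
proof -
  obtain R where R: "\<And>i j. i < n \<Longrightarrow> j < n \<Longrightarrow> (\<Sum>k<n. g i k * R k j) = imat_one i j"
    using assms(1) unfolding block_invertible_def by blast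
  have "x i = (\<Sum>j<n. x j * imat_one j i)"
    using i by (simp add: imat_one_def if_distrib cong: if_cong)
  also have "\<dots> = (\<Sum>j<n. \<Sum>k<n. x j * g j k * R k i)"
    using i by (simp add: R[symmetric] sum_distrib_left mult.assoc)
  also have "\<dots> = (\<Sum>k<n. (\<Sum>j<n. x j * g j k) * R k i)"
    by (subst sum.swap) (simp add: sum_distrib_right)
  also have "\<dots> = 0"
    by (simp add: x)
  finally show ?thesis .
qed

lemma block_invertible_solve:
  assumes "block_invertible g n"
  shows "\<exists>x. \<forall>k<n. (\<Sum>j<n. x j * g j k) = b k"
proof -
  obtain R where R: "\<And>i j. i < n \<Longrightarrow> j < n \<Longrightarrow> (\<Sum>k<n. R i k * g k j) = imat_one i j"
    using assms unfolding block_invertible_def by blast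
  have "(\<Sum>j<n. (\<Sum>i<n. b i * R i j) * g j k) = b k" if k: "k < n" for k
  proof -
    have "(\<Sum>j<n. (\<Sum>i<n. b i * R i j) * g j k) = (\<Sum>j<n. \<Sum>i<n. b i * (R i j * g j k))"
      by (simp add: sum_distrib_right mult.assoc)
    also have "\<dots> = (\<Sum>i<n. b i * (\<Sum>j<n. R i j * g j k))"
      by (subst sum.swap) (simp add: sum_distrib_left)
    also have "\<dots> = b k"
      using k by (simp add: R imat_one_def if_distrib cong: if_cong)
    finally show ?thesis .
  qed
  then show ?thesis
    by (intro exI[of _ "\<lambda>j. \<Sum>i<n. b i * R i j"]) auto
qed

text \<open>
  Row \<open>l\<close> of the left factor solves the linear system that makes row \<open>l\<close> of \<open>S g\<close> vanish to the
  left of the diagonal. The matrix of this system is the leading \<open>l \<times> l\<close> block of \<open>g\<close>, so the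
  rows are determined independently of each other.
\<close>

lemma unitriangularizing_factor_exists:
  assumes "\<And>n. block_invertible g n"
  shows "\<exists>S. ilower_unitriangular S \<and> iupper_triangular (imat_mult S g)"
proof -
  have "\<exists>x. \<forall>k<l. (\<Sum>j<l. x j * g j k) = - g l k" for l
    using block_invertible_solve[OF assms, of l "\<lambda>k. - g l k"] .
  then obtain x where x: "\<And>l k. k < l \<Longrightarrow> (\<Sum>j<l. x l j * g j k) = - g l k"
    by metis
  define S where "S l j = (if j < l then x l j else if j = l then 1 else 0)" for l j
  have S: "ilower_unitriangular S"
    by (auto simp: ilower_unitriangular_def ilower_triangular_def S_def)
  moreover have "iupper_triangular (imat_mult S g)"
    unfolding iupper_triangular_def
  proof (intro allI impI)
    fix l k :: nat assume kl: "k < l"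
    have "imat_mult S g l k = (\<Sum>j<l. S l j * g j k) + S l l * g l k"
      using S by (simp add: imat_mult_lower ilower_unitriangular_def flip: lessThan_Suc_atMost)
    also have "\<dots> = 0"
      using x[OF kl] by (simp add: S_def)
    finally show "imat_mult S g l k = 0" .
  qed
  ultimately show ?thesis
    by blast
qed

lemma unitriangularizing_factor_unique:
  assumes g: "\<And>n. block_invertible g n"
    and S: "ilower_unitriangular S" "iupper_triangular (imat_mult S g)"
    and S': "ilower_unitriangular S'" "iupper_triangular (imat_mult S' g)"
  shows "S = S'"
proof (intro ext)
  fix l i
  have "(\<Sum>j<l. (S l j - S' l j) * g j k) = 0" if "k < l" for k
  proof -
    have "(\<Sum>j<l. S l j * g j k) + g l k = imat_mult S g l k"
      "(\<Sum>j<l. S' l j * g j k) + g l k = imat_mult S' g l k"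
      using S(1) S'(1)
      by (simp_all add: imat_mult_lower ilower_unitriangular_def flip: lessThan_Suc_atMost)
    then show ?thesis
      using S(2) S'(2) that
      by (simp add: iupper_triangular_def left_diff_distrib sum_subtractf)
        (metis add_right_cancel)
  qed
  then have "S l i - S' l i = 0" if "i < l"
    using block_invertible_left_kernel[OF g, of l "\<lambda>j. S l j - S' l j"] that by blast
  then show "S l i = S' l i"
    using S(1) S'(1)
    by (cases i l rule: linorder_cases) (auto simp: ilower_unitriangular_def ilower_triangular_def)
qed

text \<open>A vanishing diagonal entry would put row \<open>l\<close> of \<open>S\<close> into the left kernel of the leading
  block of size \<open>l + 1\<close>, although its last entry is 1.\<close>

lemma unitriangularized_diagonal_nonzero:
  assumes g: "block_invertible g (Suc l)"
    and S: "ilower_unitriangular S" "iupper_triangular (imat_mult S g)"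
  shows "imat_mult S g l l \<noteq> 0"
proof
  assume 0: "imat_mult S g l l = 0"
  have "(\<Sum>j<Suc l. S l j * g j k) = 0" if "k < Suc l" for k
  proof -
    have "(\<Sum>j<Suc l. S l j * g j k) = imat_mult S g l k"
      using S(1) by (simp only: imat_mult_lower ilower_unitriangular_def lessThan_Suc_atMost)
    also have "\<dots> = 0"
      using 0 S(2) that by (cases "k = l") (auto simp: iupper_triangular_def)
    finally show ?thesis .
  qed
  from block_invertible_left_kernel[OF g this, of l] show False
    using S(1) by (simp add: ilower_unitriangular_def)
qed

text \<open>Multiplication by \<open>S\<close> turns the defining equation of the factorization into one from which the
  lower inverse has disappeared.\<close>

lemma lower_inverse_factor_iff:
  assumes "ilower_unitriangular S"
  shows "g = imat_mult (lower_inverse S) U \<longleftrightarrow> imat_mult S g = U"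
proof -
  have S: "ilower_triangular S" "\<And>i. S i i \<noteq> 0"
    using assms by (auto simp: ilower_unitriangular_def)
  note inv = lower_inverse[OF S]
  have "imat_mult S (imat_mult (lower_inverse S) U) = U"
    by (simp add: imat_mult_one_left inv(2) flip: imat_mult_assoc_lower_lower[OF S(1) inv(1)])
  moreover have "imat_mult (lower_inverse S) (imat_mult S g) = g"
    by (simp add: imat_mult_one_left inv(3) flip: imat_mult_assoc_lower_lower[OF inv(1) S(1)])
  ultimately show ?thesis
    by metis
qed

lemma gauss_factors:
  assumes "\<And>n. block_invertible (cmv_moment_matrix \<mu>) n"
  shows S1_lower_unitriangular: "ilower_unitriangular (S1 \<mu>)"
    and S2_upper_triangular: "iupper_triangular (S2 \<mu>)"
    and S2_eq: "S2 \<mu> = imat_mult (S1 \<mu>) (cmv_moment_matrix \<mu>)"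
    and S2_diagonal_nonzero: "S2 \<mu> l l \<noteq> 0"
proof -
  let ?g = "cmv_moment_matrix \<mu>"
  let ?P = "\<lambda>S. ilower_unitriangular (fst S) \<and> iupper_triangular (snd S) \<and>
    ?g = imat_mult (lower_inverse (fst S)) (snd S)"
  have P_iff: "?P (A, B) \<longleftrightarrow>
      ilower_unitriangular A \<and> iupper_triangular B \<and> imat_mult A ?g = B" for A B
    using lower_inverse_factor_iff[of A ?g B] by auto
  obtain A where A: "ilower_unitriangular A" "iupper_triangular (imat_mult A ?g)"
    using unitriangularizing_factor_exists[OF assms] by blast
  have "gauss_factors \<mu> = (A, imat_mult A ?g)"
    unfolding gauss_factors_def
  proof (rule the_equality)
    show "?P (A, imat_mult A ?g)"
      using A unfolding P_iff by simp
  next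
    fix S assume "?P S"
    then have S: "ilower_unitriangular (fst S)" "iupper_triangular (snd S)"
      "imat_mult (fst S) ?g = snd S"
      using P_iff[of "fst S" "snd S"] by simp_all
    then have "fst S = A"
      using A by (intro unitriangularizing_factor_unique[OF assms]) simp_all
    then show "S = (A, imat_mult A ?g)"
      using S(3) by (auto simp: prod_eq_iff)
  qed
  then have eq: "S1 \<mu> = A" "S2 \<mu> = imat_mult A ?g"
    by (simp_all add: S1_def S2_def)
  show "ilower_unitriangular (S1 \<mu>)" "iupper_triangular (S2 \<mu>)"
    "S2 \<mu> = imat_mult (S1 \<mu>) ?g"
    using A by (simp_all add: eq)
  show "S2 \<mu> l l \<noteq> 0"
    using unitriangularized_diagonal_nonzero[OF assms A] by (simp add: eq)
qed

text \<open>Multiply \<open>g = S\<^sub>1\<^sup>-\<^sup>1 S\<^sub>2\<close> by \<open>S\<^sub>2\<^sup>-\<^sup>1\<close> from the right.\<close>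

lemma lower_inverse_S1_eq:
  assumes "\<And>n. block_invertible (cmv_moment_matrix \<mu>) n"
  shows "lower_inverse (S1 \<mu>) = imat_mult (cmv_moment_matrix \<mu>) (upper_inverse (S2 \<mu>))"
proof -
  note gf = gauss_factors[OF assms]
  have S1: "ilower_triangular (S1 \<mu>)" "\<And>i. S1 \<mu> i i \<noteq> 0"
    using gf(1) by (auto simp: ilower_unitriangular_def)
  note up = upper_inverse[OF gf(2) gf(4)]
  have "cmv_moment_matrix \<mu> = imat_mult (lower_inverse (S1 \<mu>)) (S2 \<mu>)"
    using gf(3) by (subst lower_inverse_factor_iff[OF gf(1)]) simp
  then have "imat_mult (cmv_moment_matrix \<mu>) (upper_inverse (S2 \<mu>)) =
      imat_mult (lower_inverse (S1 \<mu>)) (imat_mult (S2 \<mu>) (upper_inverse (S2 \<mu>)))"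
    by (simp add: imat_mult_assoc_lower_upper[OF lower_inverse_lower[OF S1] up(1)])
  then show ?thesis
    by (simp add: up(2) imat_mult_one_right)
qed


section \<open>Integration against bounded densities\<close>

lemma bounded_on_circle:
  fixes f :: "complex \<Rightarrow> complex"
  assumes "continuous_on circle f"
  shows "\<exists>K. \<forall>u\<in>circle. norm (f u) \<le> K"
  using compact_imp_bounded[OF compact_continuous_image[OF assms compact_sphere]]
  unfolding bounded_iff by blast

text \<open>The common setting of positive measures and of measures with a continuous density. It is also
  closed under conjugation, so that every result applies to the conjugate measure as well.\<close>

locale bounded_density_measure =
  fixes \<mu> :: circle_measure
  assumes sets_eq: "sets (fst \<mu>) = sets circle_borel"
    and finite: "finite_measure (fst \<mu>)"
    and density_measurable: "snd \<mu> \<in> borel_measurable (fst \<mu>)"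
    and density_bounded: "\<exists>B. \<forall>u\<in>circle. norm (snd \<mu> u) \<le> B"
begin

lemma space_eq: "space (fst \<mu>) = circle"
  using sets_eq_imp_space_eq[OF sets_eq] by (simp add: circle_borel_def space_restrict_space)

lemma integrable_continuous:
  assumes "continuous_on circle f"
  shows "integrable (fst \<mu>) (\<lambda>u. f u * snd \<mu> u)"
proof -
  interpret finite_measure "fst \<mu>"
    by (rule finite)
  obtain B where B: "\<And>u. u \<in> circle \<Longrightarrow> norm (snd \<mu> u) \<le> B"
    using density_bounded by blast
  obtain K where K: "\<And>u. u \<in> circle \<Longrightarrow> norm (f u) \<le> K"
    using bounded_on_circle[OF assms] by blast
  have "f \<in> borel_measurable circle_borel"
    unfolding circle_borel_def by (rule borel_measurable_continuous_on_restrict[OF assms])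
  then have [measurable]: "f \<in> borel_measurable (fst \<mu>)"
    by (simp add: measurable_cong_sets[OF sets_eq])
  note density_measurable [measurable]
  show ?thesis
  proof (rule integrable_const_bound)
    show "AE u in fst \<mu>. norm (f u * snd \<mu> u) \<le> K * B"
    proof (rule AE_I2)
      fix u assume "u \<in> space (fst \<mu>)"
      then have u: "u \<in> circle"
        by (simp add: space_eq)
      show "norm (f u * snd \<mu> u) \<le> K * B"
        unfolding norm_mult
        using K[OF u] B[OF u] order_trans[OF norm_ge_zero K[OF u]] by (intro mult_mono) simp_all
    qed
  qed measurable
qed

lemma cintegral_cong:
  "(\<And>u. u \<in> circle \<Longrightarrow> f u = f' u) \<Longrightarrow> cintegral \<mu> f = cintegral \<mu> f'"
  unfolding cintegral_def by (rule Bochner_Integration.integral_cong) (auto simp: space_eq)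

lemma cintegral_sum:
  assumes "\<And>i. i \<in> I \<Longrightarrow> continuous_on circle (f i)"
  shows "cintegral \<mu> (\<lambda>u. \<Sum>i\<in>I. c i * f i u) = (\<Sum>i\<in>I. c i * cintegral \<mu> (f i))"
proof -
  have "cintegral \<mu> (\<lambda>u. \<Sum>i\<in>I. c i * f i u) = (LINT u|fst \<mu>. (\<Sum>i\<in>I. c i * (f i u * snd \<mu> u)))"
    by (simp add: cintegral_def sum_distrib_right mult.assoc)
  also have "\<dots> = (\<Sum>i\<in>I. (LINT u|fst \<mu>. c i * (f i u * snd \<mu> u)))"
    using assms by (intro Bochner_Integration.integral_sum integrable_mult_right integrable_continuous)
  finally show ?thesis
    by (simp add: cintegral_def)
qed

lemma conj_bounded_density_measure: "bounded_density_measure (conj_measure \<mu>)"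
proof (rule bounded_density_measure.intro)
  show "sets (fst (conj_measure \<mu>)) = sets circle_borel" "finite_measure (fst (conj_measure \<mu>))"
    by (simp_all add: conj_measure_def sets_eq finite)
  show "snd (conj_measure \<mu>) \<in> borel_measurable (fst (conj_measure \<mu>))"
    using measurable_compose[OF density_measurable, of cnj borel]
    by (simp add: conj_measure_def borel_measurable_continuous_onI continuous_on_cnj)
  show "\<exists>B. \<forall>u\<in>circle. norm (snd (conj_measure \<mu>) u) \<le> B"
    using density_bounded by (simp add: conj_measure_def)
qed

text \<open>The terms are dominated by a convergent geometric series, which permits the interchange of
  sum and integral.\<close>

lemma cintegral_geometric_series:
  assumes f: "continuous_on circle f" and q: "continuous_on circle q"
    and r: "\<And>u. u \<in> circle \<Longrightarrow> norm (q u) \<le> r" "r < 1"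
  shows "(\<lambda>m. cintegral \<mu> (\<lambda>u. f u * q u ^ m)) sums cintegral \<mu> (\<lambda>u. f u / (1 - q u))"
proof -
  let ?t = "\<lambda>m u. f u * q u ^ m * snd \<mu> u"
  have r0: "0 \<le> r"
    using order_trans[OF norm_ge_zero r(1)[of 1]] by simp
  have int: "integrable (fst \<mu>) (?t m)" for m
    using f q by (intro integrable_continuous continuous_intros)
  have norm_t: "norm (?t m u) \<le> r ^ m * norm (f u * snd \<mu> u)" if "u \<in> circle" for m u
  proof -
    have "norm (q u ^ m) \<le> r ^ m"
      using r(1)[OF that] by (simp add: norm_power power_mono)
    from mult_right_mono[OF this norm_ge_zero[of "f u * snd \<mu> u"]] show ?thesis
      by (simp add: norm_mult ac_simps)
  qed
  have "(\<lambda>m. LINT u|fst \<mu>. ?t m u) sums (LINT u|fst \<mu>. (\<Sum>m. ?t m u))"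
  proof (rule sums_integral[OF int])
    show "AE u in fst \<mu>. summable (\<lambda>m. norm (?t m u))"
    proof (rule AE_I2)
      fix u assume u: "u \<in> space (fst \<mu>)"
      show "summable (\<lambda>m. norm (?t m u))"
      proof (rule summable_comparison_test')
        show "summable (\<lambda>m. r ^ m * norm (f u * snd \<mu> u))"
          using r(2) r0 by (intro summable_mult2 summable_geometric) simp
        show "norm (norm (?t m u)) \<le> r ^ m * norm (f u * snd \<mu> u)" if "0 \<le> m" for m
          using norm_t[of u m] u by (simp add: space_eq)
      qed
    qed
    show "summable (\<lambda>m. LINT u|fst \<mu>. norm (?t m u))"
    proof (rule summable_comparison_test')
      show "summable (\<lambda>m. r ^ m * (LINT u|fst \<mu>. norm (f u * snd \<mu> u)))"
        using r(2) r0 by (intro summable_mult2 summable_geometric) simp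
      fix m :: nat
      have "(LINT u|fst \<mu>. norm (?t m u)) \<le> (LINT u|fst \<mu>. r ^ m * norm (f u * snd \<mu> u))"
        using norm_t[of _ m]
        by (intro integral_mono integrable_norm integrable_mult_right int integrable_continuous f)
          (simp add: space_eq)
      then show "norm (LINT u|fst \<mu>. norm (?t m u)) \<le> r ^ m * (LINT u|fst \<mu>. norm (f u * snd \<mu> u))"
        by (simp add: integral_nonneg_AE)
    qed
  qed
  also have "(LINT u|fst \<mu>. (\<Sum>m. ?t m u)) = cintegral \<mu> (\<lambda>u. f u / (1 - q u))"
    unfolding cintegral_def
  proof (rule Bochner_Integration.integral_cong[OF refl])
    fix u assume "u \<in> space (fst \<mu>)"
    then have "norm (q u) < 1"
      using r by (force simp: space_eq)
    then have "(\<lambda>m. f u * q u ^ m * snd \<mu> u) sums (f u * (1 / (1 - q u)) * snd \<mu> u)"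
      by (intro sums_mult sums_mult2 geometric_sums)
    then show "(\<Sum>m. ?t m u) = f u / (1 - q u) * snd \<mu> u"
      by (simp add: sums_iff)
  qed
  finally show ?thesis
    by (simp add: cintegral_def)
qed

end

lemma cintegral_conj_measure_cnj:
  "cintegral (conj_measure \<mu>) (\<lambda>u. cnj (f u)) = cnj (cintegral \<mu> f)"
  by (simp add: cintegral_def conj_measure_def flip: complex_cnj_mult)

lemma bounded_density_measure_positive:
  assumes "positive_circle_measure \<mu>"
  shows "bounded_density_measure \<mu>"
proof (rule bounded_density_measure.intro)
  show "sets (fst \<mu>) = sets circle_borel" "finite_measure (fst \<mu>)"
    "snd \<mu> \<in> borel_measurable (fst \<mu>)"
    using assms by (simp_all add: positive_circle_measure_def)
  show "\<exists>B. \<forall>u\<in>circle. norm (snd \<mu> u) \<le> B"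
    using assms by (intro exI[of _ 1]) (simp add: positive_circle_measure_def)
qed

lemma bounded_density_measure_continuous_density:
  assumes "continuous_density_measure \<mu>"
  shows "bounded_density_measure \<mu>"
proof (rule bounded_density_measure.intro)
  have \<mu>: "fst \<mu> = arc_measure" and cont: "continuous_on circle (snd \<mu>)"
    using assms by (auto simp: continuous_density_measure_def)
  show sets_eq: "sets (fst \<mu>) = sets circle_borel"
    by (simp add: \<mu> arc_measure_def)
  have cis: "cis \<in> measurable (restrict_space lborel {0..<2 * pi}) circle_borel"
    unfolding circle_borel_def
    by (intro measurable_restrict_space1 measurable_restrict_space2)
      (auto simp: measurable_lborel1 intro!: borel_measurable_continuous_onI continuous_intros)
  have "finite_measure (restrict_space lborel {0..<2 * pi})"
    by (rule finite_measureI) (simp add: emeasure_restrict_space space_restrict_space)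
  then show "finite_measure (fst \<mu>)"
    unfolding \<mu> arc_measure_def by (rule finite_measure.finite_measure_distr) (rule cis)
  show "snd \<mu> \<in> borel_measurable (fst \<mu>)"
    using borel_measurable_continuous_on_restrict[OF cont]
    by (simp add: measurable_cong_sets[OF sets_eq] circle_borel_def)
  show "\<exists>B. \<forall>u\<in>circle. norm (snd \<mu> u) \<le> B"
    by (rule bounded_on_circle[OF cont])
qed


section \<open>The CMV basis on the circle\<close>

definition cmv_exponent :: "nat \<Rightarrow> int" where
  "cmv_exponent j = (if even j then int (j div 2) else - int (j div 2) - 1)"

lemma chi_even: "chi u (2 * m) = u ^ m"
  and chi_odd: "chi u (Suc (2 * m)) = inverse u ^ Suc m"
  by (simp_all add: chi_def chi1_def chi2_star_def chi2_def)

lemma chi_eq_powi: "u \<noteq> 0 \<Longrightarrow> chi u j = u powi cmv_exponent j"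
  by (cases "even j")
    (auto elim!: evenE oddE simp: chi_even chi_odd cmv_exponent_def power_int_def nat_add_distrib)

lemma cnj_eq_inverse_on_circle: "u \<in> circle \<Longrightarrow> cnj u = inverse u"
  using complex_norm_square[of u] by (auto intro!: inverse_unique[symmetric])

lemma continuous_on_chi: "continuous_on circle (\<lambda>u. chi u j)"
  by (cases "even j") (auto elim!: evenE oddE simp: chi_even chi_odd intro!: continuous_intros)

lemma chi_mult_cnj_chi:
  assumes "u \<in> circle"
  shows "chi u i * cnj (chi u j) = u powi (cmv_exponent i - cmv_exponent j)"
proof -
  have "u \<noteq> 0"
    using assms by auto
  then show ?thesis
    using assms
    by (simp add: chi_eq_powi cnj_eq_inverse_on_circle power_int_diff power_int_inverse
        divide_inverse)
qed

text \<open>The exponents of \<open>\<chi>\<^sup>(\<^sup>0\<^sup>), \<dots>, \<chi>\<^sup>(\<^sup>n\<^sup>-\<^sup>1\<^sup>)\<close> fill an interval whose smallest element is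
  \<open>- (n div 2)\<close>, because \<open>n div 2\<close> of these indices are odd.\<close>

lemma cmv_index_bij:
  "bij_betw (\<lambda>i. nat (cmv_exponent i + int (n div 2))) {..<n} {..<n}" (is "bij_betw ?\<sigma> _ _")
proof -
  have "inj_on ?\<sigma> {..<n}"
    by (auto simp: inj_on_def cmv_exponent_def nat_eq_iff split: if_splits elim!: evenE oddE)
  moreover have "?\<sigma> ` {..<n} \<subseteq> {..<n}"
    by (auto simp: cmv_exponent_def nat_less_iff)
  ultimately show ?thesis
    by (simp add: bij_betw_def endo_inj_surj)
qed

text \<open>The moments depend on the differences of exponents only, so the shift by \<open>n div 2\<close> does not
  change them, and the leading block is a symmetrically permuted Toeplitz matrix. The matrix of
  order \<open>n\<close> among the Toeplitz matrices has \<open>n + 1\<close> rows, hence the case distinction.\<close>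

lemma quasi_definite_block_invertible:
  assumes "bounded_density_measure \<mu>" and "quasi_definite \<mu>"
  shows "block_invertible (cmv_moment_matrix \<mu>) n"
proof (cases n)
  case 0
  then show ?thesis
    by (simp add: block_invertible_def)
next
  case (Suc m)
  interpret bounded_density_measure \<mu>
    by fact
  let ?T = "\<lambda>i j :: nat. cintegral \<mu> (\<lambda>u. u powi (int i - int j))"
  let ?\<sigma> = "\<lambda>i. nat (cmv_exponent i + int (n div 2))"
  have "Determinant.det (Matrix.mat n n (\<lambda>(i, j). ?T i j)) \<noteq> 0"
    using assms(2) by (simp add: quasi_definite_def toeplitz_matrix_def Suc)
  then have "block_invertible ?T n"
    by (rule block_invertible_if_det_nonzero)
  then show ?thesis
  proof (rule block_invertible_reindex[OF _ cmv_index_bij])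
    fix i j assume "i < n" "j < n"
    then have "0 \<le> cmv_exponent i + int (n div 2)" "0 \<le> cmv_exponent j + int (n div 2)"
      by (auto simp: cmv_exponent_def elim!: evenE oddE)
    then have "int (?\<sigma> i) - int (?\<sigma> j) = cmv_exponent i - cmv_exponent j"
      by simp
    then show "cmv_moment_matrix \<mu> i j = ?T (?\<sigma> i) (?\<sigma> j)"
      unfolding cmv_moment_matrix_def by (intro cintegral_cong) (simp only: chi_mult_cnj_chi)
  qed
qed


section \<open>Second kind functions as Cauchy integrals\<close>

lemma cintegral_mult_left: "cintegral \<mu> (\<lambda>u. c * f u) = c * cintegral \<mu> f"
  by (simp add: cintegral_def mult.assoc)

lemma sums_chi1_star:
  assumes "(\<lambda>m. a (2 * m) * inverse z ^ m) sums s"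
  shows "(\<lambda>k. a k * chi1_star z k) sums (inverse z * s)"
proof -
  have "(\<lambda>m. a (2 * m) * chi1_star z (2 * m)) sums (inverse z * s)"
    using sums_mult[OF assms, of "inverse z"]
    by (simp add: chi1_star_def chi1_def ac_simps)
  then show ?thesis
    by (subst (asm) sums_mono_reindex[of "\<lambda>m. 2 * m" "\<lambda>k. a k * chi1_star z k"])
      (auto simp: strict_mono_def chi1_star_def chi1_def elim!: evenE)
qed

lemma sums_chi2:
  assumes "(\<lambda>m. a (Suc (2 * m)) * z ^ m) sums s"
  shows "(\<lambda>k. a k * chi2 z k) sums s"
proof -
  have "(\<lambda>m. a (Suc (2 * m)) * chi2 z (Suc (2 * m))) sums s"
    using assms by (simp add: chi2_def)
  then show ?thesis
    by (subst (asm) sums_mono_reindex[of "\<lambda>m. Suc (2 * m)" "\<lambda>k. a k * chi2 z k"])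
      (auto simp: strict_mono_def chi2_def elim!: oddE)
qed

context bounded_density_measure
begin

text \<open>The series of \<open>1 / (1 - (zu)\<^sup>-\<^sup>1) = u / (u - z\<^sup>-\<^sup>1)\<close> in powers of \<open>(zu)\<^sup>-\<^sup>1\<close>.\<close>

lemma fourier_chi1_star_sums_cauchy:
  assumes f: "continuous_on circle f" and z: "norm z > 1"
  shows "(\<lambda>k. cintegral \<mu> (\<lambda>u. f u * cnj (chi u k)) * chi1_star z k) sums
    (inverse z * cintegral \<mu> (\<lambda>u. u * f u / (u - inverse z)))"
proof (rule sums_chi1_star)
  let ?q = "\<lambda>u. inverse z * inverse u"
  have "(\<lambda>m. cintegral \<mu> (\<lambda>u. f u * ?q u ^ m)) sums cintegral \<mu> (\<lambda>u. f u / (1 - ?q u))"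
  proof (rule cintegral_geometric_series[OF f])
    show "continuous_on circle ?q"
      by (intro continuous_intros) auto
    show "norm (?q u) \<le> inverse (norm z)" if "u \<in> circle" for u
      using that by (simp add: norm_mult norm_inverse)
    show "inverse (norm z) < 1"
      using z by (simp add: inverse_less_1_iff)
  qed
  moreover have "cintegral \<mu> (\<lambda>u. f u * ?q u ^ m) =
      cintegral \<mu> (\<lambda>u. f u * cnj (chi u (2 * m))) * inverse z ^ m" for m
  proof -
    have "cintegral \<mu> (\<lambda>u. f u * ?q u ^ m) =
        cintegral \<mu> (\<lambda>u. inverse z ^ m * (f u * cnj (chi u (2 * m))))"
      by (rule cintegral_cong)
        (simp add: chi_even cnj_eq_inverse_on_circle power_mult_distrib)
    then show ?thesis
      by (simp add: cintegral_mult_left)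
  qed
  moreover have "cintegral \<mu> (\<lambda>u. f u / (1 - ?q u)) =
      cintegral \<mu> (\<lambda>u. u * f u / (u - inverse z))"
  proof (rule cintegral_cong)
    fix u :: complex assume "u \<in> circle"
    then have u: "u \<noteq> 0"
      by auto
    have "u - inverse z = u * (1 - ?q u)"
      using u by (simp add: right_diff_distrib)
    then show "f u / (1 - ?q u) = u * f u / (u - inverse z)"
      using u by simp
  qed
  ultimately show "(\<lambda>m. cintegral \<mu> (\<lambda>u. f u * cnj (chi u (2 * m))) * inverse z ^ m) sums
      cintegral \<mu> (\<lambda>u. u * f u / (u - inverse z))"
    by simp
qed

text \<open>The series of \<open>u / (1 - zu) = - z\<^sup>-\<^sup>1 u / (u - z\<^sup>-\<^sup>1)\<close> in powers of \<open>zu\<close>. The odd entries of \<open>\<chi>\<close>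
  start at \<open>u\<^sup>-\<^sup>1\<close>, which accounts for the additional factor \<open>u\<close>.\<close>

lemma fourier_chi2_sums_cauchy:
  assumes f: "continuous_on circle f" and z: "0 < norm z" "norm z < 1"
  shows "(\<lambda>k. cintegral \<mu> (\<lambda>u. f u * cnj (chi u k)) * chi2 z k) sums
    (- inverse z * cintegral \<mu> (\<lambda>u. u * f u / (u - inverse z)))"
proof (rule sums_chi2)
  let ?q = "\<lambda>u. z * u"
  have z0: "z \<noteq> 0"
    using z by auto
  have "(\<lambda>m. cintegral \<mu> (\<lambda>u. u * f u * ?q u ^ m)) sums
      cintegral \<mu> (\<lambda>u. u * f u / (1 - ?q u))"
    using f z(2)
    by (intro cintegral_geometric_series[where r = "norm z"] continuous_intros)
      (simp_all add: norm_mult)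
  moreover have "cintegral \<mu> (\<lambda>u. u * f u * ?q u ^ m) =
      cintegral \<mu> (\<lambda>u. f u * cnj (chi u (Suc (2 * m)))) * z ^ m" for m
  proof -
    have "cintegral \<mu> (\<lambda>u. u * f u * ?q u ^ m) =
        cintegral \<mu> (\<lambda>u. z ^ m * (f u * cnj (chi u (Suc (2 * m)))))"
      by (rule cintegral_cong)
        (simp add: chi_odd cnj_eq_inverse_on_circle power_mult_distrib)
    then show ?thesis
      by (simp add: cintegral_mult_left)
  qed
  moreover have "cintegral \<mu> (\<lambda>u. u * f u / (1 - ?q u)) =
      - inverse z * cintegral \<mu> (\<lambda>u. u * f u / (u - inverse z))"
  proof -
    have "u * f u / (1 - ?q u) = - inverse z * (u * f u / (u - inverse z))" for u
    proof -
      have "1 - ?q u = - z * (u - inverse z)"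
        using z0 by (simp add: right_diff_distrib)
      then show ?thesis
        by (simp only: divide_inverse inverse_mult_distrib inverse_minus_eq ac_simps)
    qed
    then show ?thesis
      by (simp only: cintegral_mult_left)
  qed
  ultimately show "(\<lambda>m. cintegral \<mu> (\<lambda>u. f u * cnj (chi u (Suc (2 * m)))) * z ^ m) sums
      (- inverse z * cintegral \<mu> (\<lambda>u. u * f u / (u - inverse z)))"
    by simp
qed

lemma cintegral_chi_combination:
  "cintegral \<mu> (\<lambda>u. (\<Sum>j\<le>l. c j * chi u j) * cnj (chi u k)) =
    (\<Sum>j\<le>l. c j * cintegral \<mu> (\<lambda>u. chi u j * cnj (chi u k)))"
proof -
  have "cintegral \<mu> (\<lambda>u. \<Sum>j\<le>l. c j * (chi u j * cnj (chi u k))) =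
      (\<Sum>j\<le>l. c j * cintegral \<mu> (\<lambda>u. chi u j * cnj (chi u k)))"
    by (intro cintegral_sum continuous_intros continuous_on_chi)
  then show ?thesis
    by (simp add: sum_distrib_right mult.assoc)
qed

end

lemma imat_vec_lower:
  assumes "ilower_triangular A"
  shows "imat_vec A v i = (\<Sum>k\<le>i. A i k * v k)"
  unfolding imat_vec_def using assms by (intro suminf_finite) (auto simp: ilower_triangular_def)

context
  fixes \<mu> :: circle_measure
  assumes bounded: "bounded_density_measure \<mu>" and quasi_definite: "quasi_definite \<mu>"
begin

interpretation bounded_density_measure \<mu>
  by (rule bounded)

interpretation conj: bounded_density_measure "conj_measure \<mu>"
  by (rule conj_bounded_density_measure)

lemmas factors = gauss_factors[OF quasi_definite_block_invertible[OF bounded quasi_definite]]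

lemma S1_lower: "ilower_triangular (S1 \<mu>)"
  using factors(1) by (simp add: ilower_unitriangular_def)

lemma phi1_eq: "phi1 \<mu> l u = (\<Sum>j\<le>l. S1 \<mu> l j * chi u j)"
  by (simp add: phi1_def imat_vec_lower[OF S1_lower])

lemma phi2_eq: "phi2 \<mu> l u = (\<Sum>j\<le>l. cnj (upper_inverse (S2 \<mu>) j l) * chi u j)"
proof -
  have "ilower_triangular (imat_adjoint (upper_inverse (S2 \<mu>)))"
    using upper_inverse_upper[OF factors(2) factors(4)]
    by (simp add: ilower_triangular_def iupper_triangular_def imat_adjoint_def)
  then show ?thesis
    by (simp add: phi2_def imat_vec_lower) (simp add: imat_adjoint_def)
qed

lemma continuous_on_phi1: "continuous_on circle (phi1 \<mu> l)"
  unfolding phi1_eq[abs_def] by (intro continuous_intros continuous_on_chi)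

lemma continuous_on_phi2: "continuous_on circle (phi2 \<mu> l)"
  unfolding phi2_eq[abs_def] by (intro continuous_intros continuous_on_chi)

text \<open>\<open>S\<^sub>2 = S\<^sub>1 g\<close>, with the finite sum over a row of \<open>S\<^sub>1\<close> moved under the integral that defines
  \<open>g\<close>.\<close>

lemma S2_eq_fourier_coefficient:
  "S2 \<mu> l k = cintegral \<mu> (\<lambda>u. phi1 \<mu> l u * cnj (chi u k))"
  by (simp add: factors(3) imat_mult_lower[OF S1_lower] phi1_eq cintegral_chi_combination
      cmv_moment_matrix_def)

text \<open>The adjoint of \<open>S\<^sub>1\<^sup>-\<^sup>1 = g S\<^sub>2\<^sup>-\<^sup>1\<close>; conjugating the moments replaces \<open>\<mu>\<close> by its conjugate.\<close>

lemma S1_inv_adjoint_eq_fourier_coefficient: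
  "S1_inv_adjoint \<mu> l k = cintegral (conj_measure \<mu>) (\<lambda>u. phi2 \<mu> l u * cnj (chi u k))"
proof -
  let ?V = "upper_inverse (S2 \<mu>)"
  have V: "iupper_triangular ?V"
    using factors(2,4) by (rule upper_inverse_upper)
  have "cnj (cmv_moment_matrix \<mu> k j) =
      cintegral (conj_measure \<mu>) (\<lambda>u. chi u j * cnj (chi u k))" for j
    by (simp add: cmv_moment_matrix_def mult.commute flip: cintegral_conj_measure_cnj)
  moreover have "lower_inverse (S1 \<mu>) = imat_mult (cmv_moment_matrix \<mu>) ?V"
    by (rule lower_inverse_S1_eq[OF quasi_definite_block_invertible[OF bounded quasi_definite]])
  ultimately show ?thesis
    by (simp add: imat_adjoint_def imat_mult_upper[OF V] phi2_eq conj.cintegral_chi_combination)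
      (simp add: mult.commute)
qed

lemma second_kind_sums:
  shows "norm z > 1 \<Longrightarrow> (\<lambda>k. S1_inv_adjoint \<mu> l k * chi1_star z k) sums
      (inverse z * cintegral (conj_measure \<mu>) (\<lambda>u. u * phi2 \<mu> l u / (u - inverse z)))"
    and "norm z > 1 \<Longrightarrow> (\<lambda>k. S2 \<mu> l k * chi1_star z k) sums
      (inverse z * cintegral \<mu> (\<lambda>u. u * phi1 \<mu> l u / (u - inverse z)))"
    and "0 < norm z \<Longrightarrow> norm z < 1 \<Longrightarrow> (\<lambda>k. S1_inv_adjoint \<mu> l k * chi2 z k) sums
      (- inverse z * cintegral (conj_measure \<mu>) (\<lambda>u. u * phi2 \<mu> l u / (u - inverse z)))"
    and "0 < norm z \<Longrightarrow> norm z < 1 \<Longrightarrow> (\<lambda>k. S2 \<mu> l k * chi2 z k) sums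
      (- inverse z * cintegral \<mu> (\<lambda>u. u * phi1 \<mu> l u / (u - inverse z)))"
  unfolding S1_inv_adjoint_eq_fourier_coefficient S2_eq_fourier_coefficient
  by (rule fourier_chi1_star_sums_cauchy fourier_chi2_sums_cauchy
      conj.fourier_chi1_star_sums_cauchy conj.fourier_chi2_sums_cauchy
      continuous_on_phi1 continuous_on_phi2; assumption?)+

end

theorem theorem2:
  fixes \<mu> :: circle_measure
  assumes "positive_circle_measure \<mu> \<or> continuous_density_measure \<mu>"
    and "quasi_definite \<mu>"
  shows "\<forall>l. \<forall>z.
    (norm z > 1 \<longrightarrow>
       imat_vec_summable (S1_inv_adjoint \<mu>) (chi1_star z) l \<and>
       C11 \<mu> l z =
         inverse z * cintegral (conj_measure \<mu>) (\<lambda>u. u * phi2 \<mu> l u / (u - inverse z)) \<and>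
       imat_vec_summable (S2 \<mu>) (chi1_star z) l \<and>
       C21 \<mu> l z =
         inverse z * cintegral \<mu> (\<lambda>u. u * phi1 \<mu> l u / (u - inverse z))) \<and>
    (0 < norm z \<and> norm z < 1 \<longrightarrow>
       imat_vec_summable (S1_inv_adjoint \<mu>) (chi2 z) l \<and>
       C12 \<mu> l z =
         - inverse z * cintegral (conj_measure \<mu>) (\<lambda>u. u * phi2 \<mu> l u / (u - inverse z)) \<and>
       imat_vec_summable (S2 \<mu>) (chi2 z) l \<and>
       C22 \<mu> l z =
         - inverse z * cintegral \<mu> (\<lambda>u. u * phi1 \<mu> l u / (u - inverse z)))"
proof -
  have \<mu>: "bounded_density_measure \<mu>"
    using assms(1) bounded_density_measure_positive bounded_density_measure_continuous_density
    by blast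
  show ?thesis
    unfolding C11_def C12_def C21_def C22_def imat_vec_def imat_vec_summable_def
    using second_kind_sums[OF \<mu> assms(2), unfolded sums_iff] by (intro allI conjI impI) simp_all
qed

end
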